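(* Let $P$ be a finite poset and let $\phi: \overline{P} \twoheadrightarrow P'$ be a quotient poset of $\overline{P}$, with associated face $F_\phi$ of the cone $C(P)$. Then $F_\phi[1]$ contains a lattice point if and only if every fibre of $\phi$, equipped with the restricted order relation, is graded.
   Context: For a finite poset $P$, $\overline{P} := P \,\dot\cup\, \{-\infty,\infty\}$ is obtained by adjoining a new minimum $-\infty$ and a new maximum $\infty$. We write $a \lessdot b$ (covering relation) if $a<b$ and no element lies strictly between $a$ and $b$. Let $M$ be the lattice of all functions $\psi:\overline{P}\to\mathbb{Z}$ with $\psi(\infty)=0$, and $M_{\mathbb{R}}$ the real vector space of all functions $\psi:\overline{P}\to\mathbb{R}$ with $\psi(\infty)=0$. "Lattice point" means an element of $M$. Set $$C(P) = \{\psi \in M_{\mathbb{R}} \mid \forall a,b\in\overline{P}:\ a\le b \Rightarrow \psi(a)\ge\psi(b)\}.$$ The facets of $C(P)$ are $F_{a\lessdot b} = \{\psi\in C(P) \mid \psi(a)=\psi(b)\}$ for the covering relations $a\lessdot b$ of $\overline{P}$. A quotient poset of a finite poset $Q$ is a poset $P'$ together with a surjective order-preserving map $\phi: Q\to P'$ with connected fibres, such that the order relation on $P'$ is the transitive hull of the relation: $a'\le' b'$ if there exist $a\in\phi^{-1}(a')$, $b\in\phi^{-1}(b')$ with $a\le b$. (Connected means that the Hasse diagram of the subset with the restricted order is connected.) For a quotient poset $\phi:\overline{P}\twoheadrightarrow P'$, $F_\phi := \bigcap_{a\lessdot b,\ \phi(a)=\phi(b)} F_{a\lessdot b}$, the intersection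 being over covering relations of $\overline{P}$ (and being $C(P)$ if there are none); it is the face of $C(P)$ of those functions that are constant on the fibres of $\phi$. Let $\sigma$ be the cone in the dual space of $M_{\mathbb{R}}$ with $\sigma^\vee = C(P)$; for each ray $\rho$ of $\sigma$ let $u_\rho$ be its primitive lattice generator. For a face $F$ of $C(P)$, $$F[1] := \{x\in M_{\mathbb{R}} \mid \langle u_\rho,x\rangle = 1 \text{ for all rays } \rho \text{ of } \sigma \text{ with } u_\rho\in F^\perp\},$$ where $F^\perp$ is the set of linear functionals vanishing on $F$. A finite poset $A$ is graded if there is an order-reversing map $\psi:A\to\mathbb{Z}$ with $\psi(a)=\psi(b)+1$ for every covering relation $a\lessdot b$ in $A$. *)

theory Defs
  imports Complex_Main "HOL-Library.Extended"
begin

section \<open>Finite posets\<close>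

text \<open>
  A finite poset is a finite subset \<open>P\<close> of an arbitrary partially ordered type, with the
  restricted order; \<open>P\<close> may be empty. Every finite poset is isomorphic to one of this form.
  The order on type \<open>'a extended\<close> has \<open>Minf\<close> and \<open>Pinf\<close> as its least and greatest
  elements and extends the order on \<open>'a\<close>.
\<close>

definition bar :: "'a::order set \<Rightarrow> 'a extended set" where
  "bar P = insert Minf (insert Pinf (Fin ` P))"

text \<open>Covering is relative to the subset \<open>A\<close>.\<close>

definition covers :: "'a::order set \<Rightarrow> 'a \<Rightarrow> 'a \<Rightarrow> bool" where
  "covers A a b \<longleftrightarrow> a \<in> A \<and> b \<in> A \<and> a < b \<and> \<not> (\<exists>c\<in>A. a < c \<and> c < b)"

definition hasse_connected :: "'a::order set \<Rightarrow> bool" where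
  "hasse_connected A \<longleftrightarrow>
     (\<forall>a\<in>A. \<forall>b\<in>A. (a, b) \<in> {(x, y). covers A x y \<or> covers A y x}\<^sup>*)"

definition graded :: "'a::order set \<Rightarrow> bool" where
  "graded A \<longleftrightarrow>
     (\<exists>\<psi> :: 'a \<Rightarrow> int. antimono_on A \<psi> \<and> (\<forall>a b. covers A a b \<longrightarrow> \<psi> a = \<psi> b + 1))"

definition fibre :: "'a set \<Rightarrow> ('a \<Rightarrow> 'b) \<Rightarrow> 'b \<Rightarrow> 'a set" where
  "fibre Q \<phi> p = {a \<in> Q. \<phi> a = p}"

definition quotient_poset :: "'a::order set \<Rightarrow> 'b::order set \<Rightarrow> ('a \<Rightarrow> 'b) \<Rightarrow> bool" where
  "quotient_poset Q P' \<phi> \<longleftrightarrow>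
     \<phi> ` Q = P' \<and> mono_on Q \<phi> \<and>
     (\<forall>p\<in>P'. hasse_connected (fibre Q \<phi> p)) \<and>
     {(p, q). p \<in> P' \<and> q \<in> P' \<and> p \<le> q} = {(\<phi> a, \<phi> b) | a b. a \<in> Q \<and> b \<in> Q \<and> a \<le> b}\<^sup>+"


section \<open>The function space, its lattice, and the cone of order-reversing functions\<close>

text \<open>Functions on \<open>bar P\<close> are encoded as total functions vanishing outside \<open>bar P\<close>.\<close>

definition M_real :: "'a::order set \<Rightarrow> ('a extended \<Rightarrow> real) set" where
  "M_real P = {\<psi>. (\<forall>a. a \<notin> bar P \<longrightarrow> \<psi> a = 0) \<and> \<psi> Pinf = 0}"

definition M_lattice :: "'a::order set \<Rightarrow> ('a extended \<Rightarrow> real) set" where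
  "M_lattice P = {\<psi> \<in> M_real P. \<forall>a\<in>bar P. \<psi> a \<in> \<int>}"

definition order_cone :: "'a::order set \<Rightarrow> ('a extended \<Rightarrow> real) set" where
  "order_cone P = {\<psi> \<in> M_real P. \<forall>a\<in>bar P. \<forall>b\<in>bar P. a \<le> b \<longrightarrow> \<psi> a \<ge> \<psi> b}"

definition cover_facet :: "'a::order set \<Rightarrow> 'a extended \<Rightarrow> 'a extended \<Rightarrow> ('a extended \<Rightarrow> real) set"
  where "cover_facet P a b = {\<psi> \<in> order_cone P. \<psi> a = \<psi> b}"

text \<open>Intersecting with \<open>order_cone P\<close> only matters when the family of facets is empty.\<close>

definition quotient_face :: "'a::order set \<Rightarrow> ('a extended \<Rightarrow> 'b) \<Rightarrow> ('a extended \<Rightarrow> real) set" where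
  "quotient_face P \<phi> =
     order_cone P \<inter> \<Inter> {cover_facet P a b | a b. covers (bar P) a b \<and> \<phi> a = \<phi> b}"


section \<open>The dual space and cones in it\<close>

type_synonym 'a functional = "('a extended \<Rightarrow> real) \<Rightarrow> real"

text \<open>
  Linear functionals on \<open>M_real P\<close> are encoded as total functions that are linear on
  \<open>M_real P\<close> and vanish outside it, so that equality of functionals is equality of functions.
\<close>

definition dual_space :: "'a::order set \<Rightarrow> 'a functional set" where
  "dual_space P =
     {u. (\<forall>x\<in>M_real P. \<forall>y\<in>M_real P. u (\<lambda>a. x a + y a) = u x + u y) \<and>
         (\<forall>c. \<forall>x\<in>M_real P. u (\<lambda>a. c * x a) = c * u x) \<and>
         (\<forall>x. x \<notin> M_real P \<longrightarrow> u x = 0)}"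

definition dual_lattice :: "'a::order set \<Rightarrow> 'a functional set" where
  "dual_lattice P = {u \<in> dual_space P. \<forall>x\<in>M_lattice P. u x \<in> \<int>}"

definition polyhedral_cone :: "'a::order set \<Rightarrow> 'a functional set \<Rightarrow> bool" where
  "polyhedral_cone P \<sigma> \<longleftrightarrow>
     (\<exists>G. finite G \<and> G \<subseteq> dual_space P \<and>
          \<sigma> = {\<lambda>x. \<Sum>g\<in>G. c g * g x | c :: 'a functional \<Rightarrow> real. \<forall>g\<in>G. c g \<ge> 0})"

definition dual_cone :: "'a::order set \<Rightarrow> 'a functional set \<Rightarrow> ('a extended \<Rightarrow> real) set" where
  "dual_cone P \<sigma> = {x \<in> M_real P. \<forall>u\<in>\<sigma>. u x \<ge> 0}"

text \<open>A ray is a one-dimensional face; faces are cut out by elements of the dual cone.\<close>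

definition is_ray :: "'a::order set \<Rightarrow> 'a functional set \<Rightarrow> 'a functional set \<Rightarrow> bool" where
  "is_ray P \<sigma> \<rho> \<longleftrightarrow>
     (\<exists>m\<in>dual_cone P \<sigma>. \<rho> = {u \<in> \<sigma>. u m = 0}) \<and>
     (\<exists>v. v \<noteq> (\<lambda>_. 0) \<and> \<rho> = {\<lambda>x. t * v x | t. t \<ge> 0})"

text \<open>The primitive generator of \<open>\<rho>\<close> is the generator of the monoid of lattice points of \<open>\<rho>\<close>.\<close>

definition primitive_generator :: "'a::order set \<Rightarrow> 'a functional set \<Rightarrow> 'a functional" where
  "primitive_generator P \<rho> =
     (THE u. u \<noteq> (\<lambda>_. 0) \<and> \<rho> \<inter> dual_lattice P = {\<lambda>x. of_nat n * u x | n. True})"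

definition annihilator :: "'a::order set \<Rightarrow> ('a extended \<Rightarrow> real) set \<Rightarrow> 'a functional set" where
  "annihilator P F = {u \<in> dual_space P. \<forall>x\<in>F. u x = 0}"

text \<open>The set \<open>F[1]\<close> for a face \<open>F\<close> of \<open>dual_cone P \<sigma>\<close>.\<close>

definition face_at_one ::
    "'a::order set \<Rightarrow> 'a functional set \<Rightarrow> ('a extended \<Rightarrow> real) set \<Rightarrow> ('a extended \<Rightarrow> real) set"
  where "face_at_one P \<sigma> F =
     {x \<in> M_real P. \<forall>\<rho>. is_ray P \<sigma> \<rho> \<longrightarrow> primitive_generator P \<rho> \<in> annihilator P F \<longrightarrow>
        primitive_generator P \<rho> x = 1}"

end

theory Submission
  imports Defs
begin

text \<open>
  For \<open>a, b\<close> in \<open>bar P\<close> let \<open>e a b\<close> be the functional \<open>\<psi> \<mapsto> \<psi> a - \<psi> b\<close>. The order cone is cut out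
  by the inequalities \<open>e a b \<ge> 0\<close> for the covering pairs, because in a finite poset a relation
  \<open>a \<le> b\<close> is a chain of covers. Farkas' lemma, applied in both directions, then identifies \<open>\<sigma>\<close>:
  applied to generators of \<open>\<sigma>\<close> it shows that \<open>\<sigma>\<close> is its own bidual and hence contains every
  \<open>e a b\<close> with \<open>a \<le> b\<close> (\<open>mem_iff_nonneg_on_dual_cone\<close>); applied to the covering pairs it shows
  that every element of \<open>\<sigma>\<close> is a nonnegative combination of the \<open>e a b\<close> for covers
  (\<open>nonneg_on_order_cone_combination\<close>).

  None of these generators is redundant: identifying \<open>a\<close> and \<open>b\<close> for a single covering pair
  leaves a partial order, and a function that strictly reverses the new order vanishes under
  \<open>e a b\<close> but under no other generator. So the rays of \<open>\<sigma>\<close> are exactly the half-lines through the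
  \<open>e a b\<close> (\<open>is_ray_iff_cover\<close>), and \<open>e a b\<close> is primitive because it takes the value 1 on the
  indicator function of \<open>a\<close>.

  The functional \<open>e a b\<close> vanishes on the face of \<open>\<phi>\<close> exactly when \<open>\<phi> a = \<phi> b\<close>: otherwise a
  strictly order-reversing function on \<open>P'\<close>, pulled back along \<open>\<phi>\<close>, lies in the face and
  separates \<open>a\<close> from \<open>b\<close>. Hence \<open>F[1]\<close> consists of the functions \<open>x\<close> with \<open>x a = x b + 1\<close>
  for every cover inside a fibre (\<open>face_at_one_quotient_face\<close>). Since fibres are order-convex,
  the covers of \<open>bar P\<close> inside a fibre are the covers of the fibre, so a lattice point of
  \<open>F[1]\<close> is the same thing as a choice of grading on each fibre, normalised at \<open>Pinf\<close>.
\<close>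

section \<open>Farkas' lemma\<close>

definition linear_form_on :: "('b \<Rightarrow> real) set \<Rightarrow> (('b \<Rightarrow> real) \<Rightarrow> real) \<Rightarrow> bool" where
  "linear_form_on S f \<longleftrightarrow> (\<forall>x\<in>S. \<forall>y\<in>S. \<forall>c. f (\<lambda>a. x a + c * y a) = f x + c * f y)"

lemma linear_form_onD:
  "linear_form_on S f \<Longrightarrow> x \<in> S \<Longrightarrow> y \<in> S \<Longrightarrow> f (\<lambda>a. x a + c * y a) = f x + c * f y"
  by (simp add: linear_form_on_def)

text \<open>
  The proof is algebraic and needs neither topology nor finite dimension. If the last inequality
  \<open>g j \<ge> 0\<close> is essential, there is a point \<open>z\<close> violating it and satisfying the others; projecting
  along \<open>z\<close> onto the kernel of \<open>g j\<close> reduces the claim to one inequality less.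
\<close>

lemma farkas:
  fixes S :: "('b \<Rightarrow> real) set" and g :: "'i \<Rightarrow> ('b \<Rightarrow> real) \<Rightarrow> real"
  assumes "finite I"
    and S: "\<And>x y c. x \<in> S \<Longrightarrow> y \<in> S \<Longrightarrow> (\<lambda>a. x a + c * y a) \<in> S"
    and "\<forall>i\<in>I. linear_form_on S (g i)" and "linear_form_on S u"
    and "\<forall>x\<in>S. (\<forall>i\<in>I. g i x \<ge> 0) \<longrightarrow> u x \<ge> 0"
  shows "\<exists>c. (\<forall>i\<in>I. c i \<ge> 0) \<and> (\<forall>x\<in>S. u x = (\<Sum>i\<in>I. c i * g i x))"
  using assms(1,3-)
proof (induction I arbitrary: g u rule: finite_induct)
  case empty
  have "u x = 0" if x: "x \<in> S" for x
  proof -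
    have "u (\<lambda>a. x a + (-2) * x a) = - u x"
      using linear_form_onD[OF empty(2) x x, of "-2"] by simp
    moreover have "u (\<lambda>a. x a + (-2) * x a) \<ge> 0" "u x \<ge> 0"
      using S[OF x x] x empty(3) by blast+
    ultimately show ?thesis by linarith
  qed
  then show ?case by simp
next
  case (insert j I)
  have gj: "linear_form_on S (g j)" and gI: "\<forall>i\<in>I. linear_form_on S (g i)"
    using insert.prems by auto
  show ?case
  proof (cases "\<forall>x\<in>S. (\<forall>i\<in>I. g i x \<ge> 0) \<longrightarrow> u x \<ge> 0")
    case True
    obtain c where c: "\<forall>i\<in>I. c i \<ge> 0" "\<forall>x\<in>S. u x = (\<Sum>i\<in>I. c i * g i x)"
      using insert.IH[OF gI insert.prems(2) True] by blast
    have "(\<Sum>i\<in>I. (c(j := 0)) i * g i x) = (\<Sum>i\<in>I. c i * g i x)" for x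
      by (rule sum.cong) (use insert.hyps in auto)
    with c show ?thesis
      by (intro exI[of _ "c(j := 0)"]) (auto simp: insert.hyps)
  next
    case False
    then obtain z where z: "z \<in> S" "\<forall>i\<in>I. g i z \<ge> 0" "u z < 0"
      by (meson not_le)
    have gz: "g j z < 0"
    proof (rule ccontr)
      assume "\<not> g j z < 0"
      then have "\<forall>i\<in>insert j I. g i z \<ge> 0" using z(2) by auto
      then have "u z \<ge> 0" using z(1) insert.prems(3) by blast
      with z(3) show False by simp
    qed
    define h where "h x = - g j x / g j z" for x
    \<comment> \<open>\<open>x + h x * z\<close> is the projection of \<open>x\<close> along \<open>z\<close> onto the kernel of \<open>g j\<close>.\<close>
    define T where "T x = (\<lambda>a. x a + h x * z a)" for x
    have T: "T x \<in> S" if "x \<in> S" for x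
      unfolding T_def using S[OF that z(1)] .
    have fT: "f (T x) = f x + h x * f z" if "linear_form_on S f" "x \<in> S" for f x
      unfolding T_def using linear_form_onD[OF that z(1)] .
    have h: "linear_form_on S h"
      unfolding linear_form_on_def h_def using linear_form_onD[OF gj]
      by (auto simp: divide_simps)
    have lin: "linear_form_on S (\<lambda>x. f x + h x * f z)" if "linear_form_on S f" for f
      using that h unfolding linear_form_on_def by (auto simp: algebra_simps)
    have nonneg: "\<forall>x\<in>S. (\<forall>i\<in>I. g i x + h x * g i z \<ge> 0) \<longrightarrow> u x + h x * u z \<ge> 0"
    proof (intro ballI impI)
      fix x assume x: "x \<in> S" and "\<forall>i\<in>I. g i x + h x * g i z \<ge> 0"
      then have "\<forall>i\<in>I. g i (T x) \<ge> 0" using fT gI by auto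
      moreover have "g j (T x) = 0"
        using fT[OF gj x] gz by (simp add: h_def)
      ultimately have "u (T x) \<ge> 0"
        using insert.prems(3) T[OF x] by auto
      then show "u x + h x * u z \<ge> 0" using fT[OF insert.prems(2) x] by simp
    qed
    obtain c where c: "\<forall>i\<in>I. c i \<ge> 0"
      "\<forall>x\<in>S. u x + h x * u z = (\<Sum>i\<in>I. c i * (g i x + h x * g i z))"
      using insert.IH[of "\<lambda>i x. g i x + h x * g i z" "\<lambda>x. u x + h x * u z", OF _ _ nonneg]
        lin gI insert.prems(2) by blast
    define s where "s = (\<Sum>i\<in>I. c i * g i z) - u z"
    have "s \<ge> 0" unfolding s_def using c(1) z
      by (smt (verit) mult_nonneg_nonneg sum_nonneg)
    define d where "d = c(j := - s / g j z)"
    have "u x = (\<Sum>i\<in>insert j I. d i * g i x)" if "x \<in> S" for x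
    proof -
      have "u x + h x * u z = (\<Sum>i\<in>I. c i * g i x) + h x * (\<Sum>i\<in>I. c i * g i z)"
        using c(2) that by (simp add: algebra_simps sum.distrib sum_distrib_left)
      then have "u x = (\<Sum>i\<in>I. c i * g i x) + h x * s"
        by (simp add: s_def algebra_simps)
      also have "(\<Sum>i\<in>I. c i * g i x) = (\<Sum>i\<in>I. d i * g i x)"
        by (rule sum.cong) (use insert.hyps in \<open>auto simp: d_def\<close>)
      also have "h x * s = d j * g j x" by (simp add: d_def h_def)
      finally show ?thesis using insert.hyps by simp
    qed
    moreover have "\<forall>i\<in>insert j I. d i \<ge> 0"
      using c(1) \<open>s \<ge> 0\<close> gz by (auto simp: d_def divide_nonneg_neg divide_nonpos_neg)
    ultimately show ?thesis by blast
  qed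
qed


section \<open>Finite posets and covers\<close>

lemma Pinf_in_bar [simp]: "Pinf \<in> bar P"
  by (simp add: bar_def)

lemma finite_bar: "finite P \<Longrightarrow> finite (bar P)"
  by (simp add: bar_def)

lemma covers_less: "covers A a b \<Longrightarrow> a \<in> A \<and> b \<in> A \<and> a < b"
  by (simp add: covers_def)

lemma cover_source_ne_Pinf: "covers (bar P) a b \<Longrightarrow> a \<noteq> Pinf"
  by (cases b) (auto simp: covers_def)

lemma finite_covers: "finite A \<Longrightarrow> finite {(a, b). covers A a b}"
  by (rule finite_subset[of _ "A \<times> A"]) (auto simp: covers_def)

lemma exists_cover_below:
  assumes "finite A" "a \<in> A" "b \<in> A" "a < b"
  shows "\<exists>c. covers A a c \<and> c \<le> b"
proof -
  let ?B = "{c \<in> A. a < c \<and> c \<le> b}"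
  obtain c where c: "c \<in> ?B" "\<forall>d\<in>?B. d \<le> c \<longrightarrow> c = d"
    using finite_has_minimal[of ?B] assms by auto
  then have "covers A a c"
    using assms(2) by (fastforce simp: covers_def)
  with c show ?thesis by auto
qed

text \<open>A relation \<open>a < b\<close> is a chain of covers, built by induction on the number of elements above \<open>a\<close>.\<close>

lemma antimono_on_if_covers:
  fixes f :: "'a::order \<Rightarrow> 'c::order"
  assumes "finite A" and cov: "\<And>a b. covers A a b \<Longrightarrow> f b \<le> f a"
  shows "antimono_on A f"
proof (rule monotone_onI)
  fix a b assume "a \<in> A" "b \<in> A" "a \<le> b"
  then show "f b \<le> f a"
  proof (induction "card {c \<in> A. a \<le> c}" arbitrary: a rule: less_induct)
    case less
    show ?case
    proof (cases "a = b")
      case False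
      then obtain c where c: "covers A a c" "c \<le> b"
        using exists_cover_below[OF assms(1)] less.prems by (metis order_le_less)
      then have "{d \<in> A. c \<le> d} \<subset> {d \<in> A. a \<le> d}"
        using covers_less[OF c(1)] by (auto dest: order_less_le_trans)
      then have "card {d \<in> A. c \<le> d} < card {d \<in> A. a \<le> d}"
        using assms(1) by (simp add: psubset_card_mono)
      then have "f b \<le> f c" using less c covers_less by blast
      then show ?thesis using cov[OF c(1)] by order
    qed simp
  qed
qed

text \<open>Fibres are order-convex, so nothing of \<open>A\<close> lies between two elements of a fibre.\<close>

lemma covers_fibre_iff:
  fixes \<phi> :: "'a::order \<Rightarrow> 'b::order"
  assumes "mono_on A \<phi>"
  shows "covers (fibre A \<phi> p) a b \<longleftrightarrow> covers A a b \<and> \<phi> a = p \<and> \<phi> b = p"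
proof -
  have "\<phi> c = p" if "c \<in> A" "a \<in> A" "b \<in> A" "a < c" "c < b" "\<phi> a = p" "\<phi> b = p" for c
    using monotone_onD[OF assms, of a c] monotone_onD[OF assms, of c b] that
    by (intro order_antisym) (auto simp: less_imp_le)
  then show ?thesis by (auto simp: covers_def fibre_def)
qed


section \<open>Functionals on the function space\<close>

lemma M_real_closed: "x \<in> M_real P \<Longrightarrow> y \<in> M_real P \<Longrightarrow> (\<lambda>a. x a + c * y a) \<in> M_real P"
  by (simp add: M_real_def)

lemma M_real_scale: "x \<in> M_real P \<Longrightarrow> (\<lambda>a. c * x a) \<in> M_real P"
  by (simp add: M_real_def)

lemma dual_space_linear: "u \<in> dual_space P \<Longrightarrow> linear_form_on (M_real P) u"
  unfolding linear_form_on_def dual_space_def by (auto simp: M_real_scale)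

lemma dual_space_outside: "u \<in> dual_space P \<Longrightarrow> x \<notin> M_real P \<Longrightarrow> u x = 0"
  unfolding dual_space_def by blast

definition diff_functional :: "'a::order set \<Rightarrow> 'a extended \<Rightarrow> 'a extended \<Rightarrow> 'a functional" where
  "diff_functional P a b = (\<lambda>x. if x \<in> M_real P then x a - x b else 0)"

lemma diff_functional_apply: "x \<in> M_real P \<Longrightarrow> diff_functional P a b x = x a - x b"
  by (simp add: diff_functional_def)

lemma diff_functional_dual_space: "diff_functional P a b \<in> dual_space P"
  unfolding dual_space_def diff_functional_def
  using M_real_closed[where c = 1] by (auto simp: M_real_scale algebra_simps)

lemma scaled_functional_dual_space:
  "u \<in> dual_space P \<Longrightarrow> (\<lambda>x. t * u x) \<in> dual_space P"
  by (auto simp: dual_space_def algebra_simps)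

lemma indicator_M_lattice:
  assumes "a \<in> bar P" "a \<noteq> Pinf"
  shows "(\<lambda>c. if c = a then 1 else 0) \<in> M_lattice P"
  using assms by (auto simp: M_lattice_def M_real_def)

lemma M_lattice_M_real: "x \<in> M_lattice P \<Longrightarrow> x \<in> M_real P"
  by (simp add: M_lattice_def)

lemma diff_functional_indicator:
  assumes "covers (bar P) a b"
  shows "diff_functional P a b (\<lambda>c. if c = a then 1 else 0) = 1"
  using indicator_M_lattice[of a P] cover_source_ne_Pinf[OF assms] covers_less[OF assms]
  by (auto simp: diff_functional_def M_lattice_M_real)

lemma diff_functional_nonzero: "covers (bar P) a b \<Longrightarrow> diff_functional P a b \<noteq> (\<lambda>_. 0)"
  by (metis diff_functional_indicator zero_neq_one)

lemma diff_functional_lattice: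
  assumes "covers (bar P) a b" "x \<in> M_lattice P"
  shows "diff_functional P a b x \<in> \<int>"
  using assms covers_less[OF assms(1)] by (auto simp: M_lattice_def diff_functional_apply)

lemma order_cone_iff_covers:
  assumes "finite P"
  shows "x \<in> order_cone P \<longleftrightarrow> x \<in> M_real P \<and> (\<forall>a b. covers (bar P) a b \<longrightarrow> x b \<le> x a)"
proof -
  have "antimono_on (bar P) x" if "\<forall>a b. covers (bar P) a b \<longrightarrow> x b \<le> x a"
    using antimono_on_if_covers[OF finite_bar[OF assms]] that by blast
  then show ?thesis
    by (auto simp: order_cone_def monotone_on_def covers_def less_imp_le)
qed

text \<open>
  Every order-reversing function on \<open>bar P\<close> becomes an element of the cone once it is normalised
  to vanish at \<open>Pinf\<close> and outside \<open>bar P\<close>.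
\<close>

definition normalise :: "'a::order set \<Rightarrow> ('a extended \<Rightarrow> real) \<Rightarrow> 'a extended \<Rightarrow> real" where
  "normalise P f = (\<lambda>c. if c \<in> bar P then f c - f Pinf else 0)"

lemma normalise_M_real: "normalise P f \<in> M_real P"
  by (auto simp: normalise_def M_real_def)

lemma normalise_diff:
  "a \<in> bar P \<Longrightarrow> b \<in> bar P \<Longrightarrow> normalise P f a - normalise P f b = f a - f b"
  by (simp add: normalise_def)

lemma normalise_order_cone:
  "(\<And>a b. a \<in> bar P \<Longrightarrow> b \<in> bar P \<Longrightarrow> a \<le> b \<Longrightarrow> f b \<le> f a) \<Longrightarrow> normalise P f \<in> order_cone P"
  unfolding order_cone_def using normalise_M_real by (auto simp: normalise_def)

text \<open>
  The witness counts the elements above \<open>c\<close> in the order obtained by identifying \<open>a\<close> with \<open>b\<close>.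
  As \<open>a\<close> is covered by \<open>b\<close>, this identification merges no other elements.
\<close>

lemma order_cone_only_one_cover_tight:
  assumes "finite P" and ab: "covers (bar P) a b"
  shows "\<exists>m\<in>order_cone P. m a = m b \<and> (\<forall>c d. covers (bar P) c d \<longrightarrow> m c = m d \<longrightarrow> c = a \<and> d = b)"
proof -
  define up where "up c = {d \<in> bar P. c \<le> d \<or> (c \<le> b \<and> a \<le> d)}" for c
  define f where "f c = real (card (up c))" for c
  have fin: "finite (up c)" for c
    using finite_bar[OF assms(1)] by (simp add: up_def)
  have sub: "up d \<subseteq> up c" if "c \<le> d" for c d
    using that by (auto simp: up_def)
  have "a < b" "a \<in> bar P" "b \<in> bar P" using covers_less[OF ab] by auto
  then have "up a = up b" by (auto simp: up_def)
  have tight: "c = a \<and> d = b" if cd: "covers (bar P) c d" and eq: "f c = f d" for c d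
  proof -
    have c: "c \<in> bar P" "d \<in> bar P" "c < d" using covers_less[OF cd] by auto
    have "up d = up c"
      using card_subset_eq[OF fin sub[of c d]] c eq by (simp add: f_def less_imp_le)
    then have "c \<in> up d" using c by (auto simp: up_def)
    then have "d \<le> b" "a \<le> c" using c by (auto simp: up_def)
    then show ?thesis using c ab by (auto simp: covers_def)
  qed
  have "normalise P f \<in> order_cone P"
    by (rule normalise_order_cone) (simp add: f_def card_mono fin sub)
  moreover have "normalise P f a = normalise P f b"
    using \<open>up a = up b\<close> \<open>a \<in> bar P\<close> \<open>b \<in> bar P\<close> by (simp add: normalise_def f_def)
  moreover have "f c = f d" if "covers (bar P) c d" "normalise P f c = normalise P f d" for c d
    using that covers_less[OF that(1)] normalise_diff[of c P d f] by simp
  ultimately show ?thesis using tight by blast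
qed


section \<open>The cone and its rays\<close>

lemma mem_iff_nonneg_on_dual_cone:
  assumes "polyhedral_cone P \<sigma>"
  shows "u \<in> \<sigma> \<longleftrightarrow> u \<in> dual_space P \<and> (\<forall>x\<in>dual_cone P \<sigma>. u x \<ge> 0)"
proof -
  obtain G where G: "finite G" "G \<subseteq> dual_space P"
    and \<sigma>: "\<sigma> = {\<lambda>x. \<Sum>g\<in>G. c g * g x | c :: 'a functional \<Rightarrow> real. \<forall>g\<in>G. c g \<ge> 0}"
    using assms by (auto simp: polyhedral_cone_def)
  have out: "(\<Sum>g\<in>G. c g * g x) = 0" if "x \<notin> M_real P" for c :: "'a functional \<Rightarrow> real" and x
    using G that by (auto intro!: sum.neutral simp: dual_space_def)
  show ?thesis
  proof
    assume u: "u \<in> \<sigma>"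
    then obtain c where c: "u = (\<lambda>x. \<Sum>g\<in>G. c g * g x)" unfolding \<sigma> by (elim CollectE exE conjE)
    have add: "g (\<lambda>a. x a + y a) = g x + g y"
      if "g \<in> G" "x \<in> M_real P" "y \<in> M_real P" for g x y
      using that G by (auto simp: dual_space_def)
    have scale: "g (\<lambda>a. t * x a) = t * g x" if "g \<in> G" "x \<in> M_real P" for g x t
      using that G by (auto simp: dual_space_def)
    have "u \<in> dual_space P"
      unfolding dual_space_def c
      by (auto simp: out add scale sum.distrib sum_distrib_left distrib_left mult.left_commute)
    then show "u \<in> dual_space P \<and> (\<forall>x\<in>dual_cone P \<sigma>. u x \<ge> 0)"
      using u by (auto simp: dual_cone_def)
  next
    assume u: "u \<in> dual_space P \<and> (\<forall>x\<in>dual_cone P \<sigma>. u x \<ge> 0)"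
    have "x \<in> dual_cone P \<sigma>" if "x \<in> M_real P" "\<forall>g\<in>G. g x \<ge> 0" for x
      using that by (auto simp: dual_cone_def \<sigma> intro!: sum_nonneg)
    then have *: "\<forall>x\<in>M_real P. (\<forall>g\<in>G. g x \<ge> 0) \<longrightarrow> u x \<ge> 0" using u by blast
    have lin: "\<forall>g\<in>G. linear_form_on (M_real P) g" "linear_form_on (M_real P) u"
      using G u dual_space_linear by auto
    have "\<exists>c. (\<forall>g\<in>G. c g \<ge> 0) \<and> (\<forall>x\<in>M_real P. u x = (\<Sum>g\<in>G. c g * g x))"
      by (rule farkas[where S = "M_real P" and g = "\<lambda>g. g" and I = G and u = u,
            OF G(1) M_real_closed lin *])
    then obtain c where c: "\<forall>g\<in>G. c g \<ge> 0" "\<forall>x\<in>M_real P. u x = (\<Sum>g\<in>G. c g * g x)"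
      by (elim exE conjE) (rule that)
    have "u = (\<lambda>x. \<Sum>g\<in>G. c g * g x)"
    proof
      fix x show "u x = (\<Sum>g\<in>G. c g * g x)"
      proof (cases "x \<in> M_real P")
        case False
        then have "u x = 0" using u by (blast intro: dual_space_outside)
        with out[OF False, of c] show ?thesis by simp
      qed (use c(2) in blast)
    qed
    then have "u = (\<lambda>x. \<Sum>g\<in>G. c g * g x) \<and> (\<forall>g\<in>G. c g \<ge> 0)"
      using c(1) by (rule conjI)
    then have "\<exists>c. u = (\<lambda>x. \<Sum>g\<in>G. c g * g x) \<and> (\<forall>g\<in>G. c g \<ge> 0)"
      by (rule exI[of _ c])
    then show "u \<in> \<sigma>" unfolding \<sigma> mem_Collect_eq .
  qed
qed

lemma nonneg_on_order_cone_combination: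
  assumes "finite P" and u: "u \<in> dual_space P" "\<forall>x\<in>order_cone P. u x \<ge> 0"
  shows "\<exists>c. (\<forall>p\<in>{(a, b). covers (bar P) a b}. c p \<ge> 0) \<and>
    u = (\<lambda>x. \<Sum>p\<in>{(a, b). covers (bar P) a b}. c p * diff_functional P (fst p) (snd p) x)"
proof -
  let ?E = "{(a, b). covers (bar P) a b}"
  let ?g = "\<lambda>p. diff_functional P (fst p) (snd p)"
  have fin: "finite ?E" using finite_covers finite_bar[OF assms(1)] by blast
  have *: "\<forall>x\<in>M_real P. (\<forall>p\<in>?E. ?g p x \<ge> 0) \<longrightarrow> u x \<ge> 0"
    using u(2) order_cone_iff_covers[OF assms(1)] by (auto simp: diff_functional_apply)
  have lin: "\<forall>p\<in>?E. linear_form_on (M_real P) (?g p)"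
    by (auto intro: dual_space_linear diff_functional_dual_space)
  have "\<exists>c. (\<forall>p\<in>?E. c p \<ge> 0) \<and> (\<forall>x\<in>M_real P. u x = (\<Sum>p\<in>?E. c p * ?g p x))"
    by (rule farkas[where S = "M_real P" and g = ?g and I = ?E and u = u,
          OF fin M_real_closed lin dual_space_linear[OF u(1)] *])
  then obtain c where c: "\<forall>p\<in>?E. c p \<ge> 0" "\<forall>x\<in>M_real P. u x = (\<Sum>p\<in>?E. c p * ?g p x)"
    by (elim exE conjE) (rule that)
  have "u x = (\<Sum>p\<in>?E. c p * ?g p x)" for x
  proof (cases "x \<in> M_real P")
    case False
    then have "u x = 0" by (rule dual_space_outside[OF u(1)])
    moreover have "(\<Sum>p\<in>?E. c p * ?g p x) = 0"
      using False by (intro sum.neutral) (auto simp: diff_functional_def)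
    ultimately show ?thesis by simp
  qed (use c(2) in blast)
  then have "u = (\<lambda>x. \<Sum>p\<in>?E. c p * ?g p x)" by (rule ext)
  with c(1) show ?thesis by (intro exI[of _ c] conjI)
qed

text \<open>
  A functional of \<open>\<sigma>\<close> vanishes at a point of the cone only if each generator occurring in it with
  positive coefficient does. For a ray, this forces a generator to lie on it; for a covering pair,
  the point at which no other generator vanishes exhibits the half-line as a face.
\<close>

lemma is_ray_iff_cover:
  fixes P :: "'a::order set"
  assumes "finite P" "polyhedral_cone P \<sigma>" and dual: "dual_cone P \<sigma> = order_cone P"
  shows "is_ray P \<sigma> \<rho> \<longleftrightarrow>
    (\<exists>a b. covers (bar P) a b \<and> \<rho> = {\<lambda>x. t * diff_functional P a b x | t. t \<ge> 0})"
proof -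
  let ?E = "{(a, b). covers (bar P) a b}"
  let ?e = "diff_functional P"
  have fin: "finite ?E" using finite_covers finite_bar[OF assms(1)] by blast
  have mem: "u \<in> \<sigma> \<longleftrightarrow> u \<in> dual_space P \<and> (\<forall>x\<in>order_cone P. u x \<ge> 0)" for u
    using mem_iff_nonneg_on_dual_cone[OF assms(2)] dual by simp
  have cone_real: "x \<in> M_real P" if "x \<in> order_cone P" for x
    using that by (simp add: order_cone_def)
  have e_nonneg: "?e a b x \<ge> 0" if "covers (bar P) a b" "x \<in> order_cone P" for a b x
    using that order_cone_iff_covers[OF assms(1)] by (auto simp: diff_functional_apply)
  have e_mem: "(\<lambda>x. t * ?e a b x) \<in> \<sigma>" if "covers (bar P) a b" "t \<ge> 0" for a b t
    unfolding mem using that e_nonneg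
    by (auto intro!: scaled_functional_dual_space diff_functional_dual_space)
  have vanish: "\<exists>c. u = (\<lambda>x. \<Sum>p\<in>?E. c p * ?e (fst p) (snd p) x) \<and>
      (\<forall>a b. covers (bar P) a b \<longrightarrow> c (a, b) \<noteq> 0 \<longrightarrow> ?e a b m = 0)"
    if u: "u \<in> \<sigma>" "u m = 0" and m: "m \<in> order_cone P" for u m
  proof -
    have "u \<in> dual_space P" "\<forall>x\<in>order_cone P. u x \<ge> 0" using u(1) mem by auto
    from nonneg_on_order_cone_combination[OF assms(1) this]
    obtain c where c: "\<forall>p\<in>?E. c p \<ge> 0"
        "u = (\<lambda>x. \<Sum>p\<in>?E. c p * ?e (fst p) (snd p) x)"
      by auto
    have "(\<Sum>p\<in>?E. c p * ?e (fst p) (snd p) m) = 0" using c(2) u(2) by simp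
    moreover have "0 \<le> c p * ?e (fst p) (snd p) m" if "p \<in> ?E" for p
      using that c(1) e_nonneg m by auto
    ultimately have "\<forall>p\<in>?E. c p * ?e (fst p) (snd p) m = 0"
      using sum_nonneg_eq_0_iff[OF fin, of "\<lambda>p. c p * ?e (fst p) (snd p) m"] by simp
    then have "\<forall>a b. covers (bar P) a b \<longrightarrow> c (a, b) \<noteq> 0 \<longrightarrow> ?e a b m = 0" by auto
    then show ?thesis using c(2) by blast
  qed
  show ?thesis
  proof
    assume "is_ray P \<sigma> \<rho>"
    then obtain m v where m: "m \<in> order_cone P" "\<rho> = {u \<in> \<sigma>. u m = 0}"
      and v: "v \<noteq> (\<lambda>_. 0)" "\<rho> = {\<lambda>x. t * v x | t. t \<ge> 0}"
      unfolding is_ray_def dual by (elim conjE bexE exE) (rule that)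
    have "v \<in> \<rho>" unfolding v(2) by (auto intro!: exI[of _ 1])
    then obtain c where c: "v = (\<lambda>x. \<Sum>p\<in>?E. c p * ?e (fst p) (snd p) x)"
      "\<forall>a b. covers (bar P) a b \<longrightarrow> c (a, b) \<noteq> 0 \<longrightarrow> ?e a b m = 0"
      using vanish m by blast
    have "\<exists>a b. covers (bar P) a b \<and> c (a, b) \<noteq> 0"
    proof (rule ccontr)
      assume "\<not> ?thesis"
      then have "v x = 0" for x unfolding c(1) by (intro sum.neutral) auto
      with v(1) show False by auto
    qed
    then obtain a b where ab: "covers (bar P) a b" "?e a b m = 0" using c(2) by blast
    have "?e a b \<in> \<rho>" unfolding m(2) using ab e_mem[OF ab(1), of 1] by simp
    then obtain t where t: "?e a b = (\<lambda>x. t * v x)" "t \<ge> 0" unfolding v(2) by blast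
    have "t \<noteq> 0" using t diff_functional_nonzero[OF ab(1)] by auto
    then have tpos: "t > 0" using t(2) by simp
    have "\<rho> = {\<lambda>x. s * ?e a b x | s. s \<ge> 0}"
    proof (intro subset_antisym subsetI)
      fix u assume "u \<in> \<rho>"
      then obtain s where s: "u = (\<lambda>x. s * v x)" "s \<ge> 0" unfolding v(2) by blast
      then have "u = (\<lambda>x. (s / t) * ?e a b x)" "s / t \<ge> 0"
        using tpos by (simp_all add: t(1))
      then show "u \<in> {\<lambda>x. s * ?e a b x | s. s \<ge> 0}" by blast
    next
      fix u assume "u \<in> {\<lambda>x. s * ?e a b x | s. s \<ge> 0}"
      then obtain s where s: "u = (\<lambda>x. s * ?e a b x)" "s \<ge> 0" by blast
      then have "u = (\<lambda>x. (s * t) * v x)" "s * t \<ge> 0"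
        using tpos by (simp_all add: t(1) mult.assoc)
      then show "u \<in> \<rho>" unfolding v(2) by blast
    qed
    with ab(1) show "\<exists>a b. covers (bar P) a b \<and> \<rho> = {\<lambda>x. t * ?e a b x | t. t \<ge> 0}" by blast
  next
    assume "\<exists>a b. covers (bar P) a b \<and> \<rho> = {\<lambda>x. t * ?e a b x | t. t \<ge> 0}"
    then obtain a b where ab: "covers (bar P) a b" and \<rho>: "\<rho> = {\<lambda>x. t * ?e a b x | t. t \<ge> 0}"
      by blast
    obtain m where m: "m \<in> order_cone P" "m a = m b"
      "\<forall>c d. covers (bar P) c d \<longrightarrow> m c = m d \<longrightarrow> c = a \<and> d = b"
      using order_cone_only_one_cover_tight[OF assms(1) ab] by blast
    have em: "?e c d m = m c - m d" for c d
      using m(1) by (simp add: diff_functional_apply cone_real)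
    have "u \<in> \<rho>" if u: "u \<in> \<sigma>" "u m = 0" for u
    proof -
      obtain c where c: "u = (\<lambda>x. \<Sum>p\<in>?E. c p * ?e (fst p) (snd p) x)"
        "\<forall>a b. covers (bar P) a b \<longrightarrow> c (a, b) \<noteq> 0 \<longrightarrow> ?e a b m = 0"
        using vanish[OF u m(1)] by blast
      have "c (x, y) = 0" if "covers (bar P) x y" "(x, y) \<noteq> (a, b)" for x y
        using c(2) m(3) em that by (metis eq_iff_diff_eq_0)
      then have "(\<Sum>p\<in>?E. c p * ?e (fst p) (snd p) z) =
          (\<Sum>p\<in>{(a, b)}. c p * ?e (fst p) (snd p) z)" for z
        using ab fin by (intro sum.mono_neutral_right) auto
      then have eq: "u = (\<lambda>x. c (a, b) * ?e a b x)" unfolding c(1) by simp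
      \<comment> \<open>The coefficient is recovered at a point of the cone where \<open>e a b\<close> is positive.\<close>
      define k where "k = normalise P (\<lambda>d. if d \<le> a then 1 else 0)"
      have k: "k \<in> order_cone P" unfolding k_def
        by (rule normalise_order_cone) auto
      have "?e a b k = 1"
        using covers_less[OF ab] normalise_diff[of a P b] cone_real[OF k]
        by (auto simp: diff_functional_apply k_def)
      then have "c (a, b) \<ge> 0" using u(1) k unfolding mem eq by (metis mult.right_neutral)
      then show ?thesis unfolding \<rho> using eq by blast
    qed
    moreover have "u \<in> \<sigma> \<and> u m = 0" if "u \<in> \<rho>" for u
      using that e_mem[OF ab] em m(2) by (auto simp: \<rho>)
    ultimately have "\<rho> = {u \<in> \<sigma>. u m = 0}" by blast
    then have "\<exists>m\<in>order_cone P. \<rho> = {u \<in> \<sigma>. u m = 0}"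
      using m(1) by (rule bexI)
    moreover have "\<exists>v. v \<noteq> (\<lambda>_. 0) \<and> \<rho> = {\<lambda>x. t * v x | t. t \<ge> 0}"
      using diff_functional_nonzero[OF ab] \<rho> by (intro exI[of _ "?e a b"] conjI)
    ultimately show "is_ray P \<sigma> \<rho>"
      unfolding is_ray_def dual by (rule conjI)
  qed
qed

text \<open>
  A multiple \<open>t\<close> of the functional takes the value \<open>t\<close> on the indicator function of \<open>a\<close>, a lattice
  point, so it is integral only for \<open>t \<in> \<int>\<close>.
\<close>

lemma primitive_generator_cover:
  assumes ab: "covers (bar P) a b"
  shows "primitive_generator P {\<lambda>x. t * diff_functional P a b x | t. t \<ge> 0} = diff_functional P a b"
proof -
  let ?e = "diff_functional P a b"
  let ?i = "\<lambda>c. if c = a then 1 else 0 :: real"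
  have ei: "?e ?i = 1" using diff_functional_indicator[OF ab] .
  have i: "?i \<in> M_lattice P"
    using indicator_M_lattice cover_source_ne_Pinf[OF ab] covers_less[OF ab] by blast
  have nat_mem: "(\<lambda>x. of_nat n * ?e x) \<in> dual_lattice P" for n
    unfolding dual_lattice_def using diff_functional_lattice[OF ab]
    by (auto intro!: scaled_functional_dual_space diff_functional_dual_space)
  have int: "\<exists>n. t = of_nat n" if "t \<ge> 0" "(\<lambda>x. t * ?e x) \<in> dual_lattice P" for t
  proof -
    have "t * ?e ?i \<in> \<int>" using that(2) i unfolding dual_lattice_def by blast
    then have "t \<in> \<int>" by (simp only: ei mult_1_right)
    then show ?thesis using that(1) by (metis Nats_cases Nats_altdef2 mem_Collect_eq)
  qed
  have eq: "{\<lambda>x. t * ?e x | t. t \<ge> 0} \<inter> dual_lattice P = {\<lambda>x. of_nat n * ?e x | n. True}"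
    (is "?L = ?R")
  proof
    show "?L \<subseteq> ?R" using int by fastforce
    show "?R \<subseteq> ?L" using nat_mem by (auto intro: exI[of _ "of_nat _"])
  qed
  show ?thesis
    unfolding primitive_generator_def eq
  proof (rule the_equality)
    show "?e \<noteq> (\<lambda>_. 0) \<and> {\<lambda>x. of_nat n * ?e x | n. True} = {\<lambda>x. of_nat n * ?e x | n. True}"
      using diff_functional_nonzero[OF ab] by simp
  next
    fix u :: "'a functional"
    assume u: "u \<noteq> (\<lambda>_. 0) \<and> {\<lambda>x. of_nat n * ?e x | n. True} = {\<lambda>x. of_nat n * u x | n. True}"
    have self: "v \<in> {\<lambda>x. of_nat n * v x | n. True}" for v :: "'a functional"
      by (auto intro!: exI[of _ "1::nat"])
    have "u \<in> {\<lambda>x. of_nat n * ?e x | n. True}"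
      by (rule subsetD[OF equalityD2[OF conjunct2[OF u]] self])
    moreover have "?e \<in> {\<lambda>x. of_nat n * u x | n. True}"
      by (rule subsetD[OF equalityD1[OF conjunct2[OF u]] self])
    ultimately obtain n k where n: "u = (\<lambda>x. of_nat n * ?e x)" and k: "?e = (\<lambda>x. of_nat k * u x)"
      by blast
    have "of_nat k * (of_nat n * ?e ?i) = ?e ?i" using n k by metis
    then have "real (k * n) = 1" by (simp only: ei) simp
    then have "n = 1" by (simp only: of_nat_eq_1_iff nat_mult_eq_1_iff)
    then show "u = ?e" using n by simp
  qed
qed


section \<open>The face of a quotient poset\<close>

text \<open>
  Covers contracted by \<open>\<phi>\<close> define the face, so only the converse has content: it needs a
  point of the face that separates \<open>a\<close> from \<open>b\<close> whenever \<open>\<phi>\<close> does.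
\<close>

lemma diff_functional_annihilator_iff:
  fixes \<phi> :: "'a::order extended \<Rightarrow> 'b::order"
  assumes "finite P" "mono_on (bar P) \<phi>" and ab: "covers (bar P) a b"
  shows "diff_functional P a b \<in> annihilator P (quotient_face P \<phi>) \<longleftrightarrow> \<phi> a = \<phi> b"
proof
  assume "\<phi> a = \<phi> b"
  then have "quotient_face P \<phi> \<subseteq> cover_facet P a b"
    using ab by (auto simp: quotient_face_def)
  then show "diff_functional P a b \<in> annihilator P (quotient_face P \<phi>)"
    unfolding annihilator_def using diff_functional_dual_space[of P a b]
    by (auto simp: cover_facet_def diff_functional_def)
next
  assume ann: "diff_functional P a b \<in> annihilator P (quotient_face P \<phi>)"
  \<comment> \<open>Counting the elements of the quotient above \<open>\<phi> c\<close> is strictly order-reversing in \<open>\<phi> c\<close>.\<close>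
  define up where "up c = {p \<in> \<phi> ` bar P. \<phi> c \<le> p}" for c
  define k where "k = normalise P (\<lambda>c. real (card (up c)))"
  have fin: "finite (up c)" for c using finite_bar[OF assms(1)] by (simp add: up_def)
  have sub: "up d \<subseteq> up c" if "c \<in> bar P" "d \<in> bar P" "c \<le> d" for c d
    using monotone_onD[OF assms(2) that] by (auto simp: up_def)
  have cone: "k \<in> order_cone P" unfolding k_def
    by (rule normalise_order_cone) (simp add: card_mono fin sub)
  have "k \<in> cover_facet P c d" if "covers (bar P) c d" "\<phi> c = \<phi> d" for c d
    using cone that covers_less[OF that(1)]
    by (simp add: cover_facet_def k_def normalise_def up_def)
  then have "k \<in> quotient_face P \<phi>" using cone by (auto simp: quotient_face_def)
  then have "diff_functional P a b k = 0" using ann by (simp add: annihilator_def)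
  then have "k a - k b = 0" using cone by (simp add: diff_functional_apply order_cone_def)
  moreover have ab': "a \<in> bar P" "b \<in> bar P" "a < b" using covers_less[OF ab] by auto
  ultimately have "card (up b) = card (up a)" by (simp add: k_def normalise_def)
  then have "up b = up a" using card_subset_eq[OF fin sub[of a b]] ab' by simp
  then have "\<phi> a \<in> up b" using ab' by (auto simp: up_def)
  then have "\<phi> b \<le> \<phi> a" by (simp add: up_def)
  then show "\<phi> a = \<phi> b" using monotone_onD[OF assms(2), of a b] ab' by simp
qed

lemma face_at_one_quotient_face:
  fixes \<phi> :: "'a::order extended \<Rightarrow> 'b::order"
  assumes "finite P" "mono_on (bar P) \<phi>" "polyhedral_cone P \<sigma>" "dual_cone P \<sigma> = order_cone P"
  shows "face_at_one P \<sigma> (quotient_face P \<phi>) =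
    {x \<in> M_real P. \<forall>a b. covers (bar P) a b \<longrightarrow> \<phi> a = \<phi> b \<longrightarrow> x a = x b + 1}"
proof -
  let ?ann = "annihilator P (quotient_face P \<phi>)"
  have "(\<forall>\<rho>. is_ray P \<sigma> \<rho> \<longrightarrow> primitive_generator P \<rho> \<in> ?ann \<longrightarrow> primitive_generator P \<rho> x = 1) \<longleftrightarrow>
      (\<forall>a b. covers (bar P) a b \<longrightarrow> \<phi> a = \<phi> b \<longrightarrow> x a = x b + 1)" (is "?L \<longleftrightarrow> ?R")
    if x: "x \<in> M_real P" for x
  proof -
    have value_one: "diff_functional P a b x = 1 \<longleftrightarrow> x a = x b + 1" for a b
      using x by (auto simp: diff_functional_apply)
    note ann = diff_functional_annihilator_iff[OF assms(1,2)]
    show ?thesis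
    proof
      assume L: ?L
      show ?R
      proof (intro allI impI)
        fix a b assume ab: "covers (bar P) a b" "\<phi> a = \<phi> b"
        let ?\<rho> = "{\<lambda>x. t * diff_functional P a b x | t. t \<ge> 0}"
        have ray: "is_ray P \<sigma> ?\<rho>"
          by (rule iffD2[OF is_ray_iff_cover[OF assms(1,3,4)]]) (rule exI[of _ a], rule exI[of _ b], intro conjI ab(1) refl)
        have "primitive_generator P ?\<rho> \<in> ?ann \<longrightarrow> primitive_generator P ?\<rho> x = 1"
          by (rule mp[OF spec[OF L] ray])
        then show "x a = x b + 1"
          unfolding primitive_generator_cover[OF ab(1)] value_one using ann[OF ab(1)] ab(2) by blast
      qed
    next
      assume R: ?R
      show ?L
      proof (intro allI impI)
        fix \<rho> assume "is_ray P \<sigma> \<rho>" and mem: "primitive_generator P \<rho> \<in> ?ann"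
        from this(1) obtain a b where ab: "covers (bar P) a b"
          and \<rho>: "\<rho> = {\<lambda>x. t * diff_functional P a b x | t. t \<ge> 0}"
          unfolding is_ray_iff_cover[OF assms(1,3,4)] by (elim exE conjE)
        have gen: "primitive_generator P \<rho> = diff_functional P a b"
          unfolding \<rho> by (rule primitive_generator_cover[OF ab])
        then have "\<phi> a = \<phi> b" using mem ann[OF ab] by simp
        then show "primitive_generator P \<rho> x = 1"
          unfolding gen value_one using R ab by blast
      qed
    qed
  qed
  then show ?thesis unfolding face_at_one_def by (simp cong: conj_cong)
qed

theorem theorem3p6:
  fixes P :: "'a::order set" and P' :: "'b::order set"
    and \<phi> :: "'a extended \<Rightarrow> 'b" and \<sigma> :: "'a functional set"
  assumes "finite P"
    and "quotient_poset (bar P) P' \<phi>"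
    and "polyhedral_cone P \<sigma>"
    and "dual_cone P \<sigma> = order_cone P"
  shows "(\<exists>x. x \<in> face_at_one P \<sigma> (quotient_face P \<phi>) \<and> x \<in> M_lattice P) \<longleftrightarrow>
         (\<forall>p\<in>P'. graded (fibre (bar P) \<phi> p))"
proof -
  have mono: "mono_on (bar P) \<phi>" and P': "P' = \<phi> ` bar P"
    using assms(2) by (auto simp: quotient_poset_def)
  note face = face_at_one_quotient_face[OF assms(1) mono assms(3,4)]
  note cov = covers_fibre_iff[OF mono]
  show ?thesis
  proof
    assume "\<exists>x. x \<in> face_at_one P \<sigma> (quotient_face P \<phi>) \<and> x \<in> M_lattice P"
    then obtain x where x: "x \<in> M_lattice P"
      "\<And>a b. covers (bar P) a b \<Longrightarrow> \<phi> a = \<phi> b \<Longrightarrow> x a = x b + 1"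
      unfolding face by blast
    show "\<forall>p\<in>P'. graded (fibre (bar P) \<phi> p)"
    proof
      fix p
      let ?A = "fibre (bar P) \<phi> p"
      have step: "\<lfloor>x a\<rfloor> = \<lfloor>x b\<rfloor> + 1" if "covers ?A a b" for a b
        using x(2)[of a b] that unfolding cov by simp
      moreover have "finite ?A" using finite_bar[OF assms(1)] by (simp add: fibre_def)
      ultimately have "antimono_on ?A (\<lambda>a. \<lfloor>x a\<rfloor>)"
        by (intro antimono_on_if_covers) simp_all
      with step show "graded ?A"
        unfolding graded_def by (intro exI[of _ "\<lambda>a. \<lfloor>x a\<rfloor>"]) simp
    qed
  next
    assume "\<forall>p\<in>P'. graded (fibre (bar P) \<phi> p)"
    then have "\<forall>p\<in>P'. \<exists>\<psi> :: _ \<Rightarrow> int. \<forall>a b. covers (fibre (bar P) \<phi> p) a b \<longrightarrow> \<psi> a = \<psi> b + 1"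
      unfolding graded_def by blast
    then obtain \<psi> :: "'b \<Rightarrow> 'a extended \<Rightarrow> int"
      where \<psi>: "\<And>p a b. p \<in> P' \<Longrightarrow> covers (fibre (bar P) \<phi> p) a b \<Longrightarrow> \<psi> p a = \<psi> p b + 1"
      by metis
    define x where "x = normalise P (\<lambda>c. of_int (\<psi> (\<phi> c) c))"
    have "x a = x b + 1" if "covers (bar P) a b" "\<phi> a = \<phi> b" for a b
      using \<psi>[of "\<phi> b" a b] that covers_less[OF that(1)]
      by (auto simp: cov P' x_def normalise_def)
    moreover have "x \<in> M_lattice P"
      unfolding M_lattice_def x_def using normalise_M_real by (auto simp: normalise_def)
    ultimately show "\<exists>x. x \<in> face_at_one P \<sigma> (quotient_face P \<phi>) \<and> x \<in> M_lattice P"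
      unfolding face using M_lattice_M_real by blast
  qed
qed

end
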